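(* Let $K$ be an arbitrary field and let $\mathcal{CA}^{\circ}$ be the category of finitely generated free commutative-associative algebras with $1$ over $K$. Then every automorphism of the category $\mathcal{CA}^{\circ}$ is semi-inner.
   Context: Fix an infinite set $X^0$. The objects of $\mathcal{CA}^{\circ}$ are the free commutative-associative unital $K$-algebras $F(X)$ (polynomial algebras over $K$) freely generated by finite subsets $X \subset X^0$; the morphisms are all $K$-algebra homomorphisms (it is a full subcategory of the variety of commutative-associative unital $K$-algebras). An automorphism of a category is a functor from the category to itself that is bijective on objects and on morphisms. A semi-linear homomorphism (semihomomorphism) from a $K$-algebra $A_1$ to a $K$-algebra $A_2$ is a pair $(\delta, f)$ with $\delta$ an automorphism of the field $K$ and $f : A_1 \to A_2$ a ring homomorphism such that $f(\alpha u) = \delta(\alpha) f(u)$ for all $\alpha \in K$, $u \in A_1$; it is a semi-isomorphism if $f$ is a ring isomorphism. An automorphism $\varphi$ of $\mathcal{CA}^{\circ}$ is called semi-inner if there exist $\delta \in \mathrm{Aut}\,K$ and a family of semi-isomorphisms $s_{F(X)} : F(X) \to \varphi(F(X))$ with the field automorphism $\delta$, one for each object $F(X)$, such that for every morphism $\nu : F(X) \to F(Y)$ one has $\varphi(\nu)\circ s_{F(X)} = s_{F(Y)} \circ \nu$. *)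

theory Defs
  imports "HOL-Library.Poly_Mapping" "HOL-Library.FuncSet"
begin

text \<open>\<open>Comp C g f\<close> is \<open>g\<close> after \<open>f\<close>; only its values at composable pairs of morphisms matter.\<close>

record ('o, 'm) category =
  Ob :: "'o set"
  Mor :: "'m set"
  Dom :: "'m \<Rightarrow> 'o"
  Cod :: "'m \<Rightarrow> 'o"
  Id :: "'o \<Rightarrow> 'm"
  Comp :: "'m \<Rightarrow> 'm \<Rightarrow> 'm"

definition is_category :: "('o, 'm) category \<Rightarrow> bool" where
  "is_category C \<longleftrightarrow>
     (\<forall>f\<in>Mor C. Dom C f \<in> Ob C \<and> Cod C f \<in> Ob C) \<and>
     (\<forall>A\<in>Ob C. Id C A \<in> Mor C \<and> Dom C (Id C A) = A \<and> Cod C (Id C A) = A) \<and>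
     (\<forall>f\<in>Mor C. \<forall>g\<in>Mor C. Cod C f = Dom C g \<longrightarrow>
        Comp C g f \<in> Mor C \<and> Dom C (Comp C g f) = Dom C f \<and> Cod C (Comp C g f) = Cod C g) \<and>
     (\<forall>f\<in>Mor C. Comp C f (Id C (Dom C f)) = f \<and> Comp C (Id C (Cod C f)) f = f) \<and>
     (\<forall>f\<in>Mor C. \<forall>g\<in>Mor C. \<forall>h\<in>Mor C. Cod C f = Dom C g \<longrightarrow> Cod C g = Dom C h \<longrightarrow>
        Comp C h (Comp C g f) = Comp C (Comp C h g) f)"

definition is_functor ::
  "('o, 'm) category \<Rightarrow> ('p, 'n) category \<Rightarrow> ('o \<Rightarrow> 'p) \<Rightarrow> ('m \<Rightarrow> 'n) \<Rightarrow> bool" where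
  "is_functor C D \<phi>o \<phi>m \<longleftrightarrow>
     (\<forall>A\<in>Ob C. \<phi>o A \<in> Ob D) \<and>
     (\<forall>f\<in>Mor C. \<phi>m f \<in> Mor D \<and> Dom D (\<phi>m f) = \<phi>o (Dom C f) \<and> Cod D (\<phi>m f) = \<phi>o (Cod C f)) \<and>
     (\<forall>A\<in>Ob C. \<phi>m (Id C A) = Id D (\<phi>o A)) \<and>
     (\<forall>f\<in>Mor C. \<forall>g\<in>Mor C. Cod C f = Dom C g \<longrightarrow> \<phi>m (Comp C g f) = Comp D (\<phi>m g) (\<phi>m f))"

definition category_automorphism ::
  "('o, 'm) category \<Rightarrow> ('o \<Rightarrow> 'o) \<Rightarrow> ('m \<Rightarrow> 'm) \<Rightarrow> bool" where
  "category_automorphism C \<phi>o \<phi>m \<longleftrightarrow>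
     is_functor C C \<phi>o \<phi>m \<and> bij_betw \<phi>o (Ob C) (Ob C) \<and> bij_betw \<phi>m (Mor C) (Mor C)"

text \<open>Polynomials over \<open>'k\<close> in the indeterminates \<open>'x\<close>: a monomial is a finitely supported
  exponent function, and a polynomial is a finitely supported coefficient function on monomials.\<close>

type_synonym ('x, 'k) mpoly = "('x \<Rightarrow>\<^sub>0 nat) \<Rightarrow>\<^sub>0 'k"

definition scale :: "'k::field \<Rightarrow> ('x, 'k) mpoly \<Rightarrow> ('x, 'k) mpoly" where
  "scale \<alpha> p = Poly_Mapping.single 0 \<alpha> * p"

definition free_alg :: "'x set \<Rightarrow> ('x, 'k::field) mpoly set" where
  "free_alg X = {p. \<forall>m\<in>Poly_Mapping.keys p. Poly_Mapping.keys m \<subseteq> X}"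

definition ring_hom_on :: "'a::comm_ring_1 set \<Rightarrow> 'b::comm_ring_1 set \<Rightarrow> ('a \<Rightarrow> 'b) \<Rightarrow> bool" where
  "ring_hom_on A B f \<longleftrightarrow> f \<in> A \<rightarrow> B \<and> f 1 = 1 \<and>
     (\<forall>u\<in>A. \<forall>v\<in>A. f (u + v) = f u + f v \<and> f (u * v) = f u * f v)"

definition alg_hom ::
  "('x, 'k::field) mpoly set \<Rightarrow> ('x, 'k) mpoly set \<Rightarrow> (('x, 'k) mpoly \<Rightarrow> ('x, 'k) mpoly) \<Rightarrow> bool" where
  "alg_hom A B f \<longleftrightarrow> ring_hom_on A B f \<and> (\<forall>\<alpha>. \<forall>u\<in>A. f (scale \<alpha> u) = scale \<alpha> (f u))"

definition field_automorphism :: "('k::field \<Rightarrow> 'k) \<Rightarrow> bool" where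
  "field_automorphism \<delta> \<longleftrightarrow> ring_hom_on UNIV UNIV \<delta> \<and> bij \<delta>"

definition semi_hom ::
  "('x, 'k::field) mpoly set \<Rightarrow> ('x, 'k) mpoly set \<Rightarrow>
   ('k \<Rightarrow> 'k) \<Rightarrow> (('x, 'k) mpoly \<Rightarrow> ('x, 'k) mpoly) \<Rightarrow> bool" where
  "semi_hom A B \<delta> f \<longleftrightarrow> field_automorphism \<delta> \<and> ring_hom_on A B f \<and>
     (\<forall>\<alpha>. \<forall>u\<in>A. f (scale \<alpha> u) = scale (\<delta> \<alpha>) (f u))"

definition semi_iso ::
  "('x, 'k::field) mpoly set \<Rightarrow> ('x, 'k) mpoly set \<Rightarrow>
   ('k \<Rightarrow> 'k) \<Rightarrow> (('x, 'k) mpoly \<Rightarrow> ('x, 'k) mpoly) \<Rightarrow> bool" where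
  "semi_iso A B \<delta> f \<longleftrightarrow> semi_hom A B \<delta> f \<and> bij_betw f A B"

text \<open>A morphism carries its source and target. Its underlying function is required to be
  \<open>undefined\<close> outside the source, so that equal maps are equal as morphisms.\<close>

datatype 'a arrow = Arrow (src: "'a set") (tgt: "'a set") (fn: "'a \<Rightarrow> 'a")

definition CA :: "'x set \<Rightarrow> (('x, 'k::field) mpoly set, ('x, 'k) mpoly arrow) category" where
  "CA X0 =
     \<lparr> Ob = {free_alg X | X. finite X \<and> X \<subseteq> X0},
       Mor = {Arrow (free_alg X) (free_alg Y) f | X Y f.
                finite X \<and> X \<subseteq> X0 \<and> finite Y \<and> Y \<subseteq> X0 \<and>
                alg_hom (free_alg X) (free_alg Y) f \<and> f \<in> extensional (free_alg X)},
       Dom = src,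
       Cod = tgt,
       Id = (\<lambda>A. Arrow A A (\<lambda>u\<in>A. u)),
       Comp = (\<lambda>g f. Arrow (src f) (tgt g) (compose (src f) (fn g) (fn f))) \<rparr>"

definition semi_inner ::
  "'x set \<Rightarrow> (('x, 'k::field) mpoly set \<Rightarrow> ('x, 'k) mpoly set) \<Rightarrow>
   (('x, 'k) mpoly arrow \<Rightarrow> ('x, 'k) mpoly arrow) \<Rightarrow> bool" where
  "semi_inner X0 \<phi>o \<phi>m \<longleftrightarrow>
     (\<exists>\<delta> s. field_automorphism \<delta> \<and>
        (\<forall>A\<in>Ob (CA X0). semi_iso A (\<phi>o A) \<delta> (s A)) \<and>
        (\<forall>\<nu>\<in>Mor (CA X0). \<forall>u\<in>src \<nu>. fn (\<phi>m \<nu>) (s (src \<nu>) u) = s (tgt \<nu>) (fn \<nu> u)))"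

lemma free_alg_one: "1 \<in> free_alg X"
  by (simp add: free_alg_def)

lemma free_alg_var: "x \<in> X \<Longrightarrow> Poly_Mapping.single (Poly_Mapping.single x 1) 1 \<in> free_alg X"
  by (simp add: free_alg_def)

lemma free_alg_add: "p \<in> free_alg X \<Longrightarrow> q \<in> free_alg X \<Longrightarrow> p + q \<in> free_alg X"
  using Poly_Mapping.keys_add[of p q] by (auto simp: free_alg_def)

lemma free_alg_mult: "p \<in> free_alg X \<Longrightarrow> q \<in> free_alg X \<Longrightarrow> p * q \<in> free_alg X"
proof -
  assume p: "p \<in> free_alg X" and q: "q \<in> free_alg X"
  have "Poly_Mapping.keys m \<subseteq> X" if "m \<in> Poly_Mapping.keys (p * q)" for m
  proof -
    obtain a b where "m = a + b" "a \<in> Poly_Mapping.keys p" "b \<in> Poly_Mapping.keys q"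
      using \<open>m \<in> Poly_Mapping.keys (p * q)\<close> keys_mult[of p q] by blast
    then show ?thesis
      using p q Poly_Mapping.keys_add[of a b] unfolding free_alg_def by blast
  qed
  then show ?thesis by (simp add: free_alg_def)
qed

lemma free_alg_scale: "p \<in> free_alg X \<Longrightarrow> scale \<alpha> p \<in> free_alg X"
  unfolding scale_def by (rule free_alg_mult) (simp_all add: free_alg_def)

lemma lookup_scale: "Poly_Mapping.lookup (scale \<alpha> p) m = \<alpha> * Poly_Mapping.lookup p m"
  by (simp add: scale_def Poly_Mapping.map.rep_eq when_def flip: mult_map_scale_conv_mult)

lemma alg_hom_compose:
  assumes "alg_hom A B f" "alg_hom B C g" "1 \<in> A"
    and "\<And>u v. u \<in> A \<Longrightarrow> v \<in> A \<Longrightarrow> u + v \<in> A"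
    and "\<And>u v. u \<in> A \<Longrightarrow> v \<in> A \<Longrightarrow> u * v \<in> A"
    and "\<And>\<alpha> u. u \<in> A \<Longrightarrow> scale \<alpha> u \<in> A"
  shows "alg_hom A C (compose A g f)"
  using assms by (auto simp: alg_hom_def ring_hom_on_def compose_def Pi_iff)

lemma is_category_CA: "is_category (CA X0)"
proof -
  have id: "alg_hom (free_alg X) (free_alg X) (\<lambda>u\<in>free_alg X. u)" for X :: "'a set"
    by (auto simp: alg_hom_def ring_hom_on_def free_alg_one free_alg_add free_alg_mult free_alg_scale)
  have comp: "alg_hom (free_alg X) (free_alg Z) (compose (free_alg X) g f)"
    if "alg_hom (free_alg X) (free_alg Y) f" "alg_hom (free_alg Y) (free_alg Z) g"
    for X Y Z :: "'a set" and f g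
    by (rule alg_hom_compose[OF that])
       (auto simp: free_alg_one free_alg_add free_alg_mult free_alg_scale)
  have pi: "f \<in> A \<rightarrow> B" if "alg_hom A B f"
    for f and A B :: "('a, 'b) mpoly set"
    using that by (simp add: alg_hom_def ring_hom_on_def)
  show ?thesis
    unfolding is_category_def
  proof (intro conjI ballI impI)
    fix f g :: "('a, 'b) mpoly arrow"
    assume "f \<in> Mor (CA X0)" "g \<in> Mor (CA X0)" "Cod (CA X0) f = Dom (CA X0) g"
    then show "Comp (CA X0) g f \<in> Mor (CA X0)"
      by (simp add: CA_def) (metis arrow.sel comp compose_extensional)
  next
    fix f g h :: "('a, 'b) mpoly arrow"
    assume "f \<in> Mor (CA X0)" "g \<in> Mor (CA X0)" "h \<in> Mor (CA X0)"
      "Cod (CA X0) f = Dom (CA X0) g" "Cod (CA X0) g = Dom (CA X0) h"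
    then show "Comp (CA X0) h (Comp (CA X0) g f) = Comp (CA X0) (Comp (CA X0) h g) f"
      by (auto simp: CA_def dest!: pi intro!: compose_assoc)
  next
    fix f :: "('a, 'b) mpoly arrow"
    assume "f \<in> Mor (CA X0)"
    then show "Comp (CA X0) f (Id (CA X0) (Dom (CA X0) f)) = f"
      by (auto simp: CA_def compose_def extensional_def fun_eq_iff)
  next
    fix f :: "('a, 'b) mpoly arrow"
    assume "f \<in> Mor (CA X0)"
    then show "Comp (CA X0) (Id (CA X0) (Cod (CA X0) f)) f = f"
      by (auto simp: CA_def compose_def extensional_def fun_eq_iff dest!: pi)
  next
    fix A :: "('a, 'b) mpoly set"
    assume "A \<in> Ob (CA X0)"
    then show "Id (CA X0) A \<in> Mor (CA X0)"
      using id by (auto simp: CA_def)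
  qed (auto simp: CA_def)
qed

end

theory Submission
  imports Defs "HOL-Computational_Algebra.Polynomial"
begin

text \<open>Elements of a free algebra \<open>A\<close> are the morphisms \<open>K[x] \<rightarrow> A\<close>. If an automorphism \<open>\<phi>\<close> of the
  category sends \<open>K[x]\<close> to an algebra \<open>K[z]\<close> in one variable, it therefore induces bijections
  \<open>s\<^sub>A : A \<rightarrow> \<phi>(A)\<close>, natural in \<open>A\<close>, once a generator of \<open>K[z]\<close> is chosen. It remains to see that
  they are ring isomorphisms which act on the constants by a field automorphism.

  That \<open>\<phi>(K[x])\<close> has one variable (\<open>phi_rank_one\<close>) is seen from idempotent endomorphisms. First,
  \<open>\<phi>(K) = K\<close>, because \<open>K\<close> is the only object whose identity is its sole endomorphism (\<open>phi_K\<close>).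
  If \<open>p(p) = p\<close> for a polynomial \<open>p\<close> in \<open>x\<close>, its degree \<open>d\<close> satisfies \<open>d\<^sup>2 = d\<close>, and so \<open>p\<close> is constant or \<open>x\<close>
  (\<open>idempotent_substitution\<close>). Hence an idempotent endomorphism of \<open>K[x]\<close> is the identity or factors
  through \<open>K\<close>; with two or more variables, sending a single variable to \<open>0\<close> is an idempotent that
  does neither.

  The affine changes of the generator of \<open>K[z]\<close> are used up to achieve \<open>s 0 = 0\<close> and \<open>s 1 = 1\<close>
  (\<open>natural_bijection_exists\<close>). By naturality the operations \<open>s\<^sup>-\<^sup>1(s u + s v)\<close>, \<open>s\<^sup>-\<^sup>1(s u - s v)\<close> and
  \<open>s\<^sup>-\<^sup>1(s u \<cdot> s v)\<close> are given by polynomials \<open>P\<close>, \<open>M\<close>, \<open>Q\<close> in two variables, the same for all objects: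
  apply \<open>s\<^sup>-\<^sup>1\<close> to the result of the operation on the images of two free variables
  (\<open>term_operation\<close>).

  The ring laws determine these polynomials, by counting degrees in \<open>x\<close> over the domain \<open>K[y]\<close>.
  From \<open>P(M(x, y), y) = x\<close> the degrees of \<open>P\<close> and \<open>M\<close> have product \<open>1\<close>, so that \<open>P = a x + b\<close> where
  \<open>a\<close> is a unit of \<open>K[y]\<close>, that is a constant; the neutral element gives \<open>b = y\<close> and \<open>a = 1\<close>.
  From \<open>Q(Q(x, y), y) = Q(x, Q(y, y))\<close> the degree \<open>d\<close> of \<open>Q\<close> satisfies \<open>d\<^sup>2 \<le> d\<close>, so that
  \<open>Q = a x + b\<close> with \<open>a\<close>, \<open>b\<close> in \<open>K[y]\<close>; then \<open>Q(0, y) = 0\<close> and \<open>Q(1, y) = y\<close> leave only \<open>Q = x y\<close>.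
  No element of \<open>K\<close> is ever substituted for \<open>y\<close> in these comparisons of degrees, which is why
  finite fields need no separate treatment.

  So every \<open>s\<^sub>A\<close> is a ring isomorphism. On \<open>K\<close> it is a field automorphism \<open>\<delta>\<close>, and naturality along
  \<open>K \<rightarrow> A\<close> shows that \<open>s\<^sub>A\<close> is semi-linear with this \<open>\<delta>\<close>.\<close>

section \<open>Evaluation of polynomials\<close>

definition cst :: "'k::field \<Rightarrow> ('x, 'k) mpoly" where
  "cst c = Poly_Mapping.single 0 c"

definition var :: "'x \<Rightarrow> ('x, 'k::field) mpoly" where
  "var v = Poly_Mapping.single (Poly_Mapping.single v 1) 1"

definition eval_monom :: "('x \<Rightarrow> 'a::comm_ring_1) \<Rightarrow> ('x \<Rightarrow>\<^sub>0 nat) \<Rightarrow> 'a" where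
  "eval_monom \<sigma> m = (\<Prod>v\<in>Poly_Mapping.keys m. \<sigma> v ^ Poly_Mapping.lookup m v)"

definition eval :: "('k::field \<Rightarrow> 'a::comm_ring_1) \<Rightarrow> ('x \<Rightarrow> 'a) \<Rightarrow> ('x, 'k) mpoly \<Rightarrow> 'a" where
  "eval \<iota> \<sigma> p = (\<Sum>m\<in>Poly_Mapping.keys p. \<iota> (Poly_Mapping.lookup p m) * eval_monom \<sigma> m)"

text \<open>The supports of two summands and of their sum differ; the additivity of \<open>eval_monom\<close> and of \<open>eval\<close>
  is therefore proved by enlarging all index sets to a common one.\<close>

lemma eval_monom_superset:
  assumes "finite S" "Poly_Mapping.keys m \<subseteq> S"
  shows "eval_monom \<sigma> m = (\<Prod>v\<in>S. \<sigma> v ^ Poly_Mapping.lookup m v)"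
  unfolding eval_monom_def using assms
  by (intro prod.mono_neutral_left) (auto simp: in_keys_iff)

lemma eval_monom_add: "eval_monom \<sigma> (m + n) = eval_monom \<sigma> m * eval_monom \<sigma> n"
proof -
  let ?S = "Poly_Mapping.keys m \<union> Poly_Mapping.keys n"
  have "Poly_Mapping.keys (m + n) \<subseteq> ?S" by (rule Poly_Mapping.keys_add)
  then show ?thesis
    by (subst (1 2 3) eval_monom_superset[where S = ?S])
       (auto simp: lookup_add power_add prod.distrib)
qed

lemma eval_superset:
  assumes "finite S" "Poly_Mapping.keys p \<subseteq> S" "\<iota> 0 = 0"
  shows "eval \<iota> \<sigma> p = (\<Sum>m\<in>S. \<iota> (Poly_Mapping.lookup p m) * eval_monom \<sigma> m)"
  unfolding eval_def using assms
  by (intro sum.mono_neutral_left) (auto simp: in_keys_iff)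

lemma ring_hom_on_zero:
  assumes "ring_hom_on A B f" "0 \<in> A"
  shows "f 0 = 0"
proof -
  have "f (0 + 0) = f 0 + f 0" using assms unfolding ring_hom_on_def by blast
  then show ?thesis by simp
qed

lemma ring_hom_on_sum:
  assumes f: "ring_hom_on (free_alg X) B f" and g: "\<And>i. i \<in> I \<Longrightarrow> g i \<in> free_alg X"
  shows "f (sum g I) = (\<Sum>i\<in>I. f (g i))"
proof -
  have 0: "0 \<in> free_alg X" by (simp add: free_alg_def)
  have "sum g I \<in> free_alg X \<and> f (sum g I) = (\<Sum>i\<in>I. f (g i))"
    using g
  proof (induction I rule: infinite_finite_induct)
    case (insert i I)
    then show ?case using f by (auto simp: free_alg_add ring_hom_on_def)
  qed (auto simp: 0 ring_hom_on_zero[OF f 0])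
  then show ?thesis ..
qed

lemma cst_in: "cst c \<in> free_alg X"
  by (simp add: free_alg_def cst_def)

lemma var_in: "var v \<in> free_alg X \<longleftrightarrow> v \<in> X"
  by (simp add: free_alg_def var_def)

lemma zero_in: "0 \<in> free_alg X"
  by (simp add: free_alg_def)

lemma uminus_in: "p \<in> free_alg X \<Longrightarrow> - p \<in> free_alg X"
  by (simp add: free_alg_def)

lemma diff_in: "p \<in> free_alg X \<Longrightarrow> q \<in> free_alg X \<Longrightarrow> p - q \<in> free_alg X"
  using free_alg_add[OF _ uminus_in, of p X q] by simp

lemma scale_cst: "scale c p = cst c * p"
  by (simp add: scale_def cst_def)

lemma cst_simps:
  "cst 0 = 0" "cst 1 = 1" "cst (c + d) = cst c + cst d" "cst (c - d) = cst c - cst d"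
  "cst (c * d) = cst c * cst d"
  by (simp_all add: cst_def single_add single_diff mult_single)

lemma cst_inject: "cst c = cst d \<longleftrightarrow> c = d"
  unfolding cst_def by (metis lookup_single_eq)

lemma cst_hom: "ring_hom_on UNIV UNIV cst"
  by (simp add: ring_hom_on_def cst_def single_add mult_single)

lemma free_alg_empty: "p \<in> free_alg {} \<longleftrightarrow> (\<exists>c. p = cst c)"
proof
  assume "p \<in> free_alg {}"
  then have "Poly_Mapping.keys p \<subseteq> {0}" by (auto simp: free_alg_def)
  then have "p = cst (Poly_Mapping.lookup p 0)"
    by (intro poly_mapping_eqI) (auto simp: cst_def lookup_single when_def in_keys_iff)
  then show "\<exists>c. p = cst c" ..
qed (auto simp: cst_in)

lemma var_neq_cst: "var v \<noteq> cst c"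
  using var_in[of v "{}"] cst_in[of c "{}"] by (metis empty_iff)

lemma var_neq_zero: "var v \<noteq> 0"
  using var_neq_cst[of v 0] by (simp add: cst_simps)

lemma sum_of_monomials:
  fixes p :: "'m \<Rightarrow>\<^sub>0 'k::comm_monoid_add"
  shows "p = (\<Sum>m\<in>Poly_Mapping.keys p. Poly_Mapping.single m (Poly_Mapping.lookup p m))"
  by (intro poly_mapping_eqI)
     (simp add: lookup_sum lookup_single when_def in_keys_iff)

lemma monomial_eq:
  fixes m :: "'x \<Rightarrow>\<^sub>0 nat" and c :: "'k::field"
  shows "Poly_Mapping.single m c = cst c * eval_monom var m"
proof -
  have pow: "var v ^ n = Poly_Mapping.single (Poly_Mapping.single v n) (1::'k)"
    for v :: 'x and n
    by (induction n) (simp_all add: var_def mult_single flip: single_one single_add)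
  have "(\<Prod>v\<in>S. (var v :: ('x, 'k) mpoly) ^ Poly_Mapping.lookup m v)
      = Poly_Mapping.single (\<Sum>v\<in>S. Poly_Mapping.single v (Poly_Mapping.lookup m v)) 1" for S :: "'x set" and m
    by (induction S rule: infinite_finite_induct) (simp_all add: pow mult_single)
  then show ?thesis
    unfolding eval_monom_def cst_def
    by (simp add: mult_single flip: sum_of_monomials)
qed

text \<open>The universal property of the polynomial algebra: a ring homomorphism is determined by its
  values on constants and variables. Every equality of composite substitutions below is
  obtained from this through \<open>ring_hom_on_eqI\<close>.\<close>

lemma ring_hom_on_eq_eval:
  fixes f :: "('x, 'k::field) mpoly \<Rightarrow> 'a::comm_ring_1"
  assumes f: "ring_hom_on (free_alg X) B f" and p: "p \<in> free_alg X"
  shows "f p = eval (\<lambda>c. f (cst c)) (\<lambda>v. f (var v)) p"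
proof -
  have pow: "u ^ n \<in> free_alg X \<and> f (u ^ n) = f u ^ n" if "u \<in> free_alg X" for u n
    by (induction n) (use f that in \<open>auto simp: ring_hom_on_def free_alg_mult free_alg_one\<close>)
  have pr: "prod g I \<in> free_alg X \<and> f (prod g I) = (\<Prod>i\<in>I. f (g i))"
    if "\<And>i. i \<in> I \<Longrightarrow> g i \<in> free_alg X" for g and I :: "'x set"
    using that
    by (induction I rule: infinite_finite_induct)
       (use f in \<open>auto simp: ring_hom_on_def free_alg_mult free_alg_one\<close>)
  have mon: "(eval_monom var m :: ('x, 'k) mpoly) \<in> free_alg X \<and> f (eval_monom var m) = eval_monom (\<lambda>v. f (var v)) m"
    if "m \<in> Poly_Mapping.keys p" for m
  proof -
    have "v \<in> X" if "v \<in> Poly_Mapping.keys m" for v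
      using p that \<open>m \<in> Poly_Mapping.keys p\<close> by (auto simp: free_alg_def)
    then have "(var v :: ('x, 'k) mpoly) ^ n \<in> free_alg X \<and> f (var v ^ n) = f (var v) ^ n"
      if "v \<in> Poly_Mapping.keys m" for v n
      using that pow[of "var v" n] var_in[of v X] by simp
    then show ?thesis
      unfolding eval_monom_def
      using pr[of "Poly_Mapping.keys m" "\<lambda>v. var v ^ Poly_Mapping.lookup m v"] by simp
  qed
  have "p = (\<Sum>m\<in>Poly_Mapping.keys p. cst (Poly_Mapping.lookup p m) * eval_monom var m)"
    by (subst sum_of_monomials) (simp add: monomial_eq)
  then have "f p = f (\<Sum>m\<in>Poly_Mapping.keys p. cst (Poly_Mapping.lookup p m) * eval_monom var m)"
    by simp
  also have "\<dots> = (\<Sum>m\<in>Poly_Mapping.keys p. f (cst (Poly_Mapping.lookup p m) * eval_monom var m))"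
    by (rule ring_hom_on_sum[OF f]) (auto simp: mon free_alg_mult cst_in)
  also have "\<dots> = eval (\<lambda>c. f (cst c)) (\<lambda>v. f (var v)) p"
    unfolding eval_def using f
    by (intro sum.cong refl) (auto simp: ring_hom_on_def mon cst_in)
  finally show ?thesis .
qed

lemma eval_cong:
  assumes "p \<in> free_alg X" "\<And>v. v \<in> X \<Longrightarrow> \<sigma> v = \<tau> v"
  shows "eval \<iota> \<sigma> p = eval \<iota> \<tau> p"
proof -
  have "\<sigma> v = \<tau> v" if "m \<in> Poly_Mapping.keys p" "v \<in> Poly_Mapping.keys m" for m v
    using that assms by (auto simp: free_alg_def)
  then show ?thesis by (simp add: eval_def eval_monom_def)
qed

lemma ring_hom_on_eqI:
  assumes "ring_hom_on (free_alg X) B f" "ring_hom_on (free_alg X) B g"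
    and "\<And>c. f (cst c) = g (cst c)" "\<And>v. v \<in> X \<Longrightarrow> f (var v) = g (var v)"
    and "p \<in> free_alg X"
  shows "f p = g p"
  using ring_hom_on_eq_eval[OF assms(1,5)] ring_hom_on_eq_eval[OF assms(2,5)]
    eval_cong[OF assms(5), of "\<lambda>v. f (var v)" "\<lambda>v. g (var v)"] assms(3,4) by simp

lemma eval_zero [simp]: "eval \<iota> \<sigma> 0 = 0"
  by (simp add: eval_def)

lemma eval_single: "\<iota> 0 = 0 \<Longrightarrow> eval \<iota> \<sigma> (Poly_Mapping.single m c) = \<iota> c * eval_monom \<sigma> m"
  by (simp add: eval_def)

lemma eval_cst: "\<iota> 0 = 0 \<Longrightarrow> eval \<iota> \<sigma> (cst c) = \<iota> c"
  by (simp add: cst_def eval_single eval_monom_def)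

lemma eval_var: "ring_hom_on UNIV UNIV \<iota> \<Longrightarrow> eval \<iota> \<sigma> (var v) = \<sigma> v"
  by (simp add: var_def eval_def eval_monom_def ring_hom_on_def)

lemma eval_add:
  assumes "ring_hom_on UNIV UNIV \<iota>"
  shows "eval \<iota> \<sigma> (p + q) = eval \<iota> \<sigma> p + eval \<iota> \<sigma> q"
proof -
  have 0: "\<iota> 0 = 0" using assms by (rule ring_hom_on_zero) simp
  let ?S = "Poly_Mapping.keys p \<union> Poly_Mapping.keys q"
  have "Poly_Mapping.keys (p + q) \<subseteq> ?S" by (rule Poly_Mapping.keys_add)
  then show ?thesis
    using assms 0
    by (subst (1 2 3) eval_superset[where S = ?S])
       (auto simp: lookup_add ring_hom_on_def distrib_right sum.distrib)
qed

lemma ring_hom_on_eval: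
  fixes \<iota> :: "'k::field \<Rightarrow> 'a::comm_ring_1" and \<sigma> :: "'x \<Rightarrow> 'a"
  assumes \<iota>: "ring_hom_on UNIV UNIV \<iota>"
  shows "ring_hom_on (free_alg X) UNIV (eval \<iota> \<sigma>)"
proof -
  have 0: "\<iota> 0 = 0" using \<iota> by (rule ring_hom_on_zero) simp
  have sm: "eval \<iota> \<sigma> (sum g I) = (\<Sum>i\<in>I. eval \<iota> \<sigma> (g i))"
    for g :: "('x \<Rightarrow>\<^sub>0 nat) \<Rightarrow> ('x, 'k) mpoly" and I
    by (induction I rule: infinite_finite_induct)
       (simp_all add: eval_add[OF \<iota>])
  have 1: "eval \<iota> \<sigma> (Poly_Mapping.single m c * Poly_Mapping.single n d)
        = eval \<iota> \<sigma> (Poly_Mapping.single m c) * eval \<iota> \<sigma> (Poly_Mapping.single n d)" for m n c d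
    using \<iota> by (simp add: mult_single eval_single[of \<iota>] 0 eval_monom_add ring_hom_on_def ac_simps)
  have "eval \<iota> \<sigma> (p * q) = eval \<iota> \<sigma> p * eval \<iota> \<sigma> q" for p q
  proof -
    let ?t = "\<lambda>p m. Poly_Mapping.single m (Poly_Mapping.lookup p m)"
    have "eval \<iota> \<sigma> ((\<Sum>m\<in>Poly_Mapping.keys p. ?t p m) * (\<Sum>m\<in>Poly_Mapping.keys q. ?t q m))
       = eval \<iota> \<sigma> (\<Sum>m\<in>Poly_Mapping.keys p. ?t p m) * eval \<iota> \<sigma> (\<Sum>m\<in>Poly_Mapping.keys q. ?t q m)"
      by (simp only: sum_product sm 1)
    then show ?thesis by (simp only: sum_of_monomials[symmetric])
  qed
  moreover have "eval \<iota> \<sigma> 1 = 1"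
    using eval_cst[of \<iota> \<sigma> 1] 0 \<iota> by (simp add: cst_def ring_hom_on_def)
  ultimately show ?thesis by (simp add: ring_hom_on_def eval_add[OF \<iota>])
qed

lemma eval_cst_in:
  fixes \<sigma> :: "'a \<Rightarrow> ('x, 'k::field) mpoly"
  assumes \<sigma>: "\<And>v. v \<in> X \<Longrightarrow> \<sigma> v \<in> free_alg Y" and p: "p \<in> free_alg X"
  shows "eval cst \<sigma> p \<in> free_alg Y"
proof -
  have s: "sum g I \<in> free_alg Y" if "\<And>i. i \<in> I \<Longrightarrow> g i \<in> free_alg Y" for g and I :: "('a \<Rightarrow>\<^sub>0 nat) set"
    using that by (induction I rule: infinite_finite_induct) (auto simp: free_alg_add zero_in)
  have pr: "prod g I \<in> free_alg Y" if "\<And>i. i \<in> I \<Longrightarrow> g i \<in> free_alg Y" for g and I :: "'a set"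
    using that by (induction I rule: infinite_finite_induct) (auto simp: free_alg_mult free_alg_one)
  have pw: "u ^ n \<in> free_alg Y" if "u \<in> free_alg Y" for u n
    using that by (induction n) (auto simp: free_alg_mult free_alg_one)
  show ?thesis
    unfolding eval_def eval_monom_def
    by (intro s free_alg_mult pr pw cst_in \<sigma>) (use p in \<open>auto simp: free_alg_def\<close>)
qed

lemma alg_hom_eval:
  assumes "\<And>v. v \<in> X \<Longrightarrow> \<sigma> v \<in> free_alg Y"
  shows "alg_hom (free_alg X) (free_alg Y) (eval cst \<sigma>)"
  using ring_hom_on_eval[OF cst_hom, of X \<sigma>] eval_cst_in[of X \<sigma> Y, OF assms]
  by (auto simp: alg_hom_def ring_hom_on_def scale_cst cst_in eval_cst cst_simps)

section \<open>Polynomials in two variables and their degrees\<close>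

text \<open>The identification of \<open>K[x, y]\<close> with \<open>K[y][x]\<close>, which makes degrees in \<open>x\<close> over an integral
  domain available. The second variable \<open>y\<close> is not named: every variable other than \<open>x\<close> becomes
  the inner indeterminate, and the map is injective on each \<open>K[x, y]\<close> separately.\<close>

definition ev :: "'x \<Rightarrow> ('x, 'k::field) mpoly \<Rightarrow> 'k poly poly" where
  "ev x = eval (\<lambda>c. [:[:c:]:]) (\<lambda>v. if v = x then [:0, 1:] else [:[:0, 1:]:])"

text \<open>The polynomial operation \<open>p(u, v)\<close> for \<open>p\<close> in \<open>K[x, y]\<close>.\<close>

definition sub2 ::
  "'x \<Rightarrow> ('x, 'k::field) mpoly \<Rightarrow> ('x, 'k) mpoly \<Rightarrow> ('x, 'k) mpoly \<Rightarrow> ('x, 'k) mpoly" where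
  "sub2 x u v = eval cst (\<lambda>i. if i = x then u else v)"

lemma const2_hom: "ring_hom_on UNIV UNIV (\<lambda>c::'k::field. [:[:c:]:])"
  by (simp add: ring_hom_on_def one_pCons)

lemma ev_hom: "ring_hom_on (free_alg X) UNIV (ev x)"
  unfolding ev_def by (rule ring_hom_on_eval[OF const2_hom])

lemma ev_cst: "ev x (cst c) = [:[:c:]:]"
  by (simp add: ev_def eval_cst)

lemma ev_var: "ev x (var v) = (if v = x then [:0, 1:] else [:[:0, 1:]:])"
  by (simp add: ev_def eval_var[OF const2_hom])

lemma sub2_hom: "ring_hom_on (free_alg X) UNIV (sub2 x u v)"
  unfolding sub2_def by (rule ring_hom_on_eval[OF cst_hom])

lemma sub2_cst: "sub2 x u v (cst c) = cst c"
  by (simp add: sub2_def eval_cst cst_simps)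

lemma sub2_var: "sub2 x u v (var i) = (if i = x then u else v)"
  by (simp add: sub2_def eval_var[OF cst_hom])

lemma sub2_in:
  assumes "p \<in> free_alg {x, y}" "u \<in> free_alg X" "v \<in> free_alg X"
  shows "sub2 x u v p \<in> free_alg X"
  unfolding sub2_def by (rule eval_cst_in[OF _ assms(1)]) (use assms in auto)

lemma ev_simps:
  fixes u v :: "('x, 'k::field) mpoly"
  shows "ev x (0 :: ('x, 'k) mpoly) = 0" "ev x (1 :: ('x, 'k) mpoly) = 1"
    "ev x (u + v) = ev x u + ev x v" "ev x (u * v) = ev x u * ev x v"
proof -
  have h: "ring_hom_on (free_alg UNIV) UNIV (ev x :: ('x, 'k) mpoly \<Rightarrow> _)" by (rule ev_hom)
  show "ev x (0 :: ('x, 'k) mpoly) = 0" by (rule ring_hom_on_zero[OF h zero_in])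
  show "ev x (1 :: ('x, 'k) mpoly) = 1" "ev x (u + v) = ev x u + ev x v" "ev x (u * v) = ev x u * ev x v"
    using h by (simp_all add: ring_hom_on_def free_alg_def)
qed

lemma sub2_simps:
  "sub2 x u v 1 = 1" "sub2 x u v (p + q) = sub2 x u v p + sub2 x u v q"
  "sub2 x u v (p * q) = sub2 x u v p * sub2 x u v q"
  using sub2_hom[of UNIV x u v] by (simp_all add: ring_hom_on_def free_alg_def)

lemma ring_hom_comp:
  assumes "ring_hom_on A UNIV f" "ring_hom_on UNIV UNIV g"
  shows "ring_hom_on A UNIV (\<lambda>p. g (f p))"
  using assms by (simp add: ring_hom_on_def)

lemma map_poly_hom:
  fixes h :: "'a::comm_ring_1 \<Rightarrow> 'b::comm_ring_1"
  assumes h: "ring_hom_on UNIV UNIV h"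
  shows "ring_hom_on UNIV UNIV (map_poly h)"
proof -
  have 0: "h 0 = 0" using h by (rule ring_hom_on_zero) simp
  have s: "h (sum g I) = (\<Sum>i\<in>I. h (g i))" for g and I :: "nat set"
    by (induction I rule: infinite_finite_induct) (use h 0 in \<open>auto simp: ring_hom_on_def\<close>)
  show ?thesis
    using h by (auto simp: ring_hom_on_def poly_eq_iff coeff_map_poly 0 coeff_mult s)
qed

lemma poly_hom: "ring_hom_on UNIV UNIV (\<lambda>p. poly p a)"
  by (simp add: ring_hom_on_def)

lemma pcompose_hom: "ring_hom_on UNIV UNIV (\<lambda>p. pcompose p q)"
  by (simp add: ring_hom_on_def pcompose_add pcompose_mult pcompose_1)

text \<open>Evaluating a polynomial over \<open>K[y]\<close> back at \<open>x\<close> and \<open>y\<close> is a ring homomorphism that inverts \<open>ev\<close>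
  on constants, on \<open>x\<close> and on \<open>y\<close>, hence on \<open>K[x, y]\<close>.\<close>

lemma ev_inject:
  assumes p: "p \<in> free_alg {x, y}" and q: "q \<in> free_alg {x, y}" and eq: "ev x p = ev x q"
  shows "p = q"
proof -
  define lift :: "'b poly poly \<Rightarrow> ('a, 'b) mpoly" where
    "lift = (\<lambda>q. poly (map_poly (\<lambda>c. poly (map_poly cst c) (var y)) q) (var x))"
  have b: "ring_hom_on UNIV UNIV lift"
    unfolding lift_def
    by (intro ring_hom_comp[OF map_poly_hom[OF ring_hom_comp[OF map_poly_hom[OF cst_hom] poly_hom]] poly_hom])
  have id: "lift (ev x r) = r" if "r \<in> free_alg {x, y}" for r
  proof (rule ring_hom_on_eqI[of "{x, y}" UNIV "\<lambda>r. lift (ev x r)" "\<lambda>r. r"])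
    show "ring_hom_on (free_alg {x, y}) UNIV (\<lambda>r. lift (ev x r))"
      by (rule ring_hom_comp[OF ev_hom b])
    show "ring_hom_on (free_alg {x, y}) UNIV (\<lambda>r. r)" by (simp add: ring_hom_on_def)
    show "lift (ev x (cst c)) = cst c" for c
      by (simp add: ev_cst lift_def map_poly_pCons cst_simps)
    show "lift (ev x (var v)) = var v" if "v \<in> {x, y}" for v
      using that by (auto simp: ev_var lift_def map_poly_pCons cst_simps)
  qed (use that in simp)
  show ?thesis using id[OF p] id[OF q] eq by metis
qed

text \<open>Replacing only \<open>x\<close> is composition of univariate polynomials over \<open>K[y]\<close>, and there degrees are
  multiplicative.\<close>

lemma ev_sub2_main:
  assumes "x \<noteq> y" "p \<in> free_alg {x, y}"
  shows "ev x (sub2 x u (var y) p) = pcompose (ev x p) (ev x u)"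
proof (rule ring_hom_on_eqI[of "{x, y}" UNIV "\<lambda>p. ev x (sub2 x u (var y) p)" "\<lambda>p. pcompose (ev x p) (ev x u)"])
  show "ring_hom_on (free_alg {x, y}) UNIV (\<lambda>p. ev x (sub2 x u (var y) p))"
    by (simp add: ring_hom_on_def sub2_simps ev_simps)
  show "ring_hom_on (free_alg {x, y}) UNIV (\<lambda>p. pcompose (ev x p) (ev x u))"
    by (rule ring_hom_comp[OF ev_hom pcompose_hom])
qed (use assms in \<open>auto simp: ev_cst ev_var sub2_cst sub2_var pcompose_pCons\<close>)

text \<open>Replacing \<open>y\<close> by an element of \<open>K[y]\<close> only changes the coefficients of the powers of \<open>x\<close>, so it
  cannot raise the degree in \<open>x\<close>.\<close>

lemma ev_sub2_coeff:
  assumes "x \<noteq> y" "p \<in> free_alg {x, y}" "ev x w = [:w':]"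
  shows "ev x (sub2 x (var x) w p) = map_poly (\<lambda>c. pcompose c w') (ev x p)"
proof (rule ring_hom_on_eqI[of "{x, y}" UNIV "\<lambda>p. ev x (sub2 x (var x) w p)" "\<lambda>p. map_poly (\<lambda>c. pcompose c w') (ev x p)"])
  show "ring_hom_on (free_alg {x, y}) UNIV (\<lambda>p. ev x (sub2 x (var x) w p))"
    by (simp add: ring_hom_on_def sub2_simps ev_simps)
  show "ring_hom_on (free_alg {x, y}) UNIV (\<lambda>p. map_poly (\<lambda>c. pcompose c w') (ev x p))"
    by (rule ring_hom_comp[OF ev_hom map_poly_hom[OF pcompose_hom]])
qed (use assms in \<open>auto simp: ev_cst ev_var sub2_cst sub2_var pcompose_pCons map_poly_pCons pcompose_1\<close>)

lemma degree_le_1E: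
  assumes "degree p \<le> 1"
  obtains a b where "p = [:b, a:]"
proof -
  have "p = [:coeff p 0, coeff p 1:]"
    using assms by (intro poly_eqI) (auto simp: coeff_pCons coeff_eq_0 split: nat.split)
  then show ?thesis by (rule that)
qed

text \<open>Comparing degrees in \<open>p(p) = p\<close> leaves \<open>p = a x + b\<close>. If \<open>a \<noteq> 0\<close>, then \<open>a\<^sup>2 = a\<close> and
  \<open>a b = 0\<close> force \<open>p = x\<close>.\<close>

lemma idempotent_substitution:
  fixes p :: "('x, 'k::field) mpoly"
  assumes "x \<noteq> y" and p: "p \<in> free_alg {x}" and idem: "sub2 x p (var y) p = p"
  shows "p = var x \<or> p \<in> free_alg {}"
proof -
  have p2: "p \<in> free_alg {x, y}" using p by (auto simp: free_alg_def)
  let ?p = "ev x p"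
  have c: "pcompose ?p ?p = ?p"
    using ev_sub2_main[OF assms(1) p2, of p] idem by simp
  then have "degree ?p * degree ?p = degree ?p" using degree_pcompose[of ?p ?p] by metis
  then have "degree ?p \<le> 1" by (cases "degree ?p") auto
  then obtain a b where ab: "?p = [:b, a:]" by (rule degree_le_1E)
  show ?thesis
  proof (cases "a = 0")
    case True
    \<comment> \<open>A priori \<open>b\<close> lies in \<open>K[y]\<close>; since \<open>x\<close> does not occur in \<open>ev x p\<close>, \<open>p\<close> equals its value
      at \<open>x = 0\<close>, which is a constant because \<open>p\<close> involves no other variable.\<close>
    have "ev x (sub2 x 0 (var y) p) = ev x p"
      using ev_sub2_main[OF assms(1) p2, of 0] ab True by (simp)
    moreover have in0: "sub2 x 0 (var y) p \<in> free_alg {}"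
      unfolding sub2_def by (rule eval_cst_in[OF _ p]) (auto simp: zero_in)
    then have "sub2 x 0 (var y) p \<in> free_alg {x, y}" by (auto simp: free_alg_def)
    ultimately show ?thesis using ev_inject p2 in0 by metis
  next
    case False
    have "a * a = a" "a * b = 0" using c ab by (simp_all add: pcompose_pCons algebra_simps)
    then have "a = 1" "b = 0" using False by simp_all
    then have "ev x p = ev x (var x)" using ab by (simp add: ev_var)
    then have "p = var x" by (rule ev_inject[OF p2, rotated]) (simp add: var_in)
    then show ?thesis ..
  qed
qed

text \<open>By \<open>P(M(x, y), y) = x\<close>, the map \<open>x \<mapsto> P(x, y)\<close> has a one-sided inverse under composition
  over \<open>K[y]\<close>. So it is linear in \<open>x\<close> with a unit of \<open>K[y]\<close> as leading coefficient, which excludes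
  formal group laws such as \<open>x + y + x y\<close>.\<close>

lemma unital_invertible_operation_is_addition:
  fixes P M :: "('x, 'k::field) mpoly"
  assumes "x \<noteq> y" and P: "P \<in> free_alg {x, y}" and M: "M \<in> free_alg {x, y}"
    and PM: "sub2 x M (var y) P = var x"
    and P0: "sub2 x 0 (var y) P = var y"
    and P1: "sub2 x 1 0 P = 1"
  shows "P = var x + var y"
proof -
  have c: "pcompose (ev x P) (ev x M) = [:0, 1:]"
    using ev_sub2_main[OF assms(1) P, of M] PM by (simp add: ev_var)
  then have "degree (ev x P) * degree (ev x M) = 1"
    using degree_pcompose[of "ev x P" "ev x M"] by simp
  then have "degree (ev x P) \<le> 1" "degree (ev x M) \<le> 1" by simp_all
  from degree_le_1E[OF this(1)] degree_le_1E[OF this(2)]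
  obtain a b a' b' where ab: "ev x P = [:b, a:]" and ab': "ev x M = [:b', a':]"
    by metis
  have "a * a' = 1" using c by (simp add: ab ab' pcompose_pCons)
  then have "a dvd 1" by (metis dvd_triv_left)
  then obtain a0 where a0: "a = [:a0:]" by (auto simp: is_unit_poly_iff)
  have "b = [:0, 1:]"
    using ev_sub2_main[OF assms(1) P, of 0] P0 assms(1) by (simp add: ev_var ab ev_simps pcompose_0')
  then have "ev x P = ev x (cst a0 * var x + var y)"
    using assms(1) by (simp add: ab a0 ev_simps ev_cst ev_var)
  then have eq: "P = cst a0 * var x + var y"
    by (rule ev_inject[OF P, rotated]) (simp add: free_alg_add free_alg_mult cst_in var_in)
  have "cst a0 = (1 :: ('x, 'k) mpoly)"
    using P1 assms(1) by (simp add: eq sub2_simps sub2_cst sub2_var)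
  then show ?thesis using eq by simp
qed

text \<open>The substitution \<open>z = y\<close> in the associative law keeps everything inside \<open>K[x, y]\<close>; it suffices,
  since the right-hand side still has at most the degree of \<open>Q\<close> in \<open>x\<close>, while the left-hand side
  has the square of that degree.\<close>

lemma unital_associative_operation_is_multiplication:
  fixes Q :: "('x, 'k::field) mpoly"
  assumes "x \<noteq> y" and Q: "Q \<in> free_alg {x, y}"
    and assoc: "sub2 x Q (var y) Q = sub2 x (var x) (sub2 x (var y) (var y) Q) Q"
    and Q0: "sub2 x 0 (var y) Q = 0"
    and Q1: "sub2 x 1 (var y) Q = var y"
  shows "Q = var x * var y"
proof -
  have "ev x (sub2 x (var y) (var y) Q) = [:poly (ev x Q) [:0, 1:]:]"
    using ev_sub2_main[OF assms(1) Q, of "var y"] assms(1) by (simp add: ev_var pcompose_pCons_0)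
  from ev_sub2_coeff[OF assms(1) Q this] ev_sub2_main[OF assms(1) Q, of Q] assoc
  have "pcompose (ev x Q) (ev x Q) = map_poly (\<lambda>c. pcompose c (poly (ev x Q) [:0, 1:])) (ev x Q)"
    by simp
  then have "degree (pcompose (ev x Q) (ev x Q)) \<le> degree (ev x Q)"
    by (simp only: map_poly_degree_leq)
  then have "degree (ev x Q) * degree (ev x Q) \<le> degree (ev x Q)" by (simp add: degree_pcompose)
  then have "degree (ev x Q) \<le> 1" by (cases "degree (ev x Q)") auto
  then obtain a b where ab: "ev x Q = [:b, a:]" by (rule degree_le_1E)
  have "b = 0"
    using ev_sub2_main[OF assms(1) Q, of 0] Q0 by (simp add: ab ev_simps pcompose_0')
  moreover have "b + a = [:0, 1:]"
    using ev_sub2_main[OF assms(1) Q, of 1] Q1 assms(1)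
    by (simp add: ab ev_simps ev_var pcompose_pCons)
  ultimately have "ev x Q = ev x (var x * var y)"
    using assms(1) by (simp add: ab ev_simps ev_var)
  then show ?thesis
    by (rule ev_inject[OF Q, rotated]) (simp add: free_alg_mult var_in)
qed

section \<open>Morphisms between free algebras\<close>

definition smor ::
  "('x, 'k::field) mpoly set \<Rightarrow> ('x, 'k) mpoly set \<Rightarrow> ('x \<Rightarrow> ('x, 'k) mpoly) \<Rightarrow> ('x, 'k) mpoly arrow" where
  "smor A B \<sigma> = Arrow A B (restrict (eval cst \<sigma>) A)"

lemma smor_simps [simp]:
  "src (smor A B \<sigma>) = A" "tgt (smor A B \<sigma>) = B" "u \<in> A \<Longrightarrow> fn (smor A B \<sigma>) u = eval cst \<sigma> u"
  by (simp_all add: smor_def)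

lemma Ob_iff: "A \<in> Ob (CA X0) \<longleftrightarrow> (\<exists>X. A = free_alg X \<and> finite X \<and> X \<subseteq> X0)"
  by (auto simp: CA_def)

lemma Mor_iff:
  "\<nu> \<in> Mor (CA X0) \<longleftrightarrow> src \<nu> \<in> Ob (CA X0) \<and> tgt \<nu> \<in> Ob (CA X0) \<and>
     alg_hom (src \<nu>) (tgt \<nu>) (fn \<nu>) \<and> fn \<nu> \<in> extensional (src \<nu>)"
  by (cases \<nu>) (auto simp: CA_def)

lemma Dom_Cod: "Dom (CA X0) = src" "Cod (CA X0) = tgt"
  by (simp_all add: CA_def)

lemma Comp_simps [simp]:
  "src (Comp (CA X0) g f) = src f" "tgt (Comp (CA X0) g f) = tgt g"
  "u \<in> src f \<Longrightarrow> fn (Comp (CA X0) g f) u = fn g (fn f u)"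
  by (simp_all add: CA_def compose_def)

lemma Comp_Mor:
  assumes "f \<in> Mor (CA X0)" "g \<in> Mor (CA X0)" "tgt f = src g"
  shows "Comp (CA X0) g f \<in> Mor (CA X0)"
  using is_category_CA[of X0] assms unfolding is_category_def Dom_Cod by blast

lemma smor_Mor:
  assumes "finite X" "X \<subseteq> X0" "B \<in> Ob (CA X0)" "\<And>v. v \<in> X \<Longrightarrow> \<sigma> v \<in> B"
  shows "smor (free_alg X) B \<sigma> \<in> Mor (CA X0)"
proof -
  obtain Y where Y: "B = free_alg Y" using assms(3) by (auto simp: Ob_iff)
  have "alg_hom (free_alg X) (free_alg Y) (restrict (eval cst \<sigma>) (free_alg X))"
    using alg_hom_eval[of X \<sigma> Y] assms(4)
    by (auto simp: Y alg_hom_def ring_hom_on_def free_alg_one free_alg_add free_alg_mult free_alg_scale)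
  then show ?thesis
    using assms unfolding Mor_iff by (auto simp: Ob_iff smor_def Y)
qed

lemma Mor_in: "\<nu> \<in> Mor (CA X0) \<Longrightarrow> u \<in> src \<nu> \<Longrightarrow> fn \<nu> u \<in> tgt \<nu>"
  by (auto simp: Mor_iff alg_hom_def ring_hom_on_def)

lemma Mor_hom: "\<nu> \<in> Mor (CA X0) \<Longrightarrow> ring_hom_on (src \<nu>) (tgt \<nu>) (fn \<nu>)"
  by (simp add: Mor_iff alg_hom_def)

lemma Ob_closed:
  assumes "A \<in> Ob (CA X0)"
  shows "cst c \<in> A" "0 \<in> A" "1 \<in> A" "u \<in> A \<Longrightarrow> v \<in> A \<Longrightarrow> u + v \<in> A"
    "u \<in> A \<Longrightarrow> v \<in> A \<Longrightarrow> u - v \<in> A" "u \<in> A \<Longrightarrow> v \<in> A \<Longrightarrow> u * v \<in> A"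
  using assms by (auto simp: Ob_iff cst_in zero_in free_alg_one free_alg_add diff_in free_alg_mult)

lemma Mor_ops:
  assumes \<nu>: "\<nu> \<in> Mor (CA X0)"
  shows "fn \<nu> (cst c) = cst c" "fn \<nu> 0 = 0" "fn \<nu> 1 = 1"
    "u \<in> src \<nu> \<Longrightarrow> v \<in> src \<nu> \<Longrightarrow> fn \<nu> (u + v) = fn \<nu> u + fn \<nu> v"
    "u \<in> src \<nu> \<Longrightarrow> v \<in> src \<nu> \<Longrightarrow> fn \<nu> (u - v) = fn \<nu> u - fn \<nu> v"
    "u \<in> src \<nu> \<Longrightarrow> v \<in> src \<nu> \<Longrightarrow> fn \<nu> (u * v) = fn \<nu> u * fn \<nu> v"
proof -
  have S: "src \<nu> \<in> Ob (CA X0)" using \<nu> by (simp add: Mor_iff)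
  note cl = Ob_closed[OF S]
  have h: "ring_hom_on (src \<nu>) (tgt \<nu>) (fn \<nu>)" using \<nu> by (rule Mor_hom)
  show 1: "fn \<nu> 1 = 1" using h by (simp add: ring_hom_on_def)
  show "fn \<nu> 0 = 0" using ring_hom_on_zero[OF h] cl by simp
  show add: "u \<in> src \<nu> \<Longrightarrow> v \<in> src \<nu> \<Longrightarrow> fn \<nu> (u + v) = fn \<nu> u + fn \<nu> v" for u v
    using h by (simp add: ring_hom_on_def)
  show "u \<in> src \<nu> \<Longrightarrow> v \<in> src \<nu> \<Longrightarrow> fn \<nu> (u * v) = fn \<nu> u * fn \<nu> v"
    using h by (simp add: ring_hom_on_def)
  show "u \<in> src \<nu> \<Longrightarrow> v \<in> src \<nu> \<Longrightarrow> fn \<nu> (u - v) = fn \<nu> u - fn \<nu> v"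
    using add[of "u - v" v] cl by simp
  have "fn \<nu> (scale c 1) = scale c (fn \<nu> 1)" using \<nu> cl(3) unfolding Mor_iff alg_hom_def by blast
  then show "fn \<nu> (cst c) = cst c" by (simp add: scale_cst 1)
qed

lemma Mor_eqI:
  assumes f: "f \<in> Mor (CA X0)" and g: "g \<in> Mor (CA X0)"
    and s: "src f = free_alg X" "src g = free_alg X" and t: "tgt f = tgt g"
    and v: "\<And>v. v \<in> X \<Longrightarrow> fn f (var v) = fn g (var v)"
  shows "f = g"
proof -
  have hf: "ring_hom_on (free_alg X) (tgt f) (fn f)" and hg: "ring_hom_on (free_alg X) (tgt f) (fn g)"
    using Mor_hom[OF f] Mor_hom[OF g] s t by simp_all
  have "fn f p = fn g p" if "p \<in> free_alg X" for p
    by (rule ring_hom_on_eqI[OF hf hg _ v that]) (simp_all only: Mor_ops(1)[OF f] Mor_ops(1)[OF g])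
  moreover have "fn f \<in> extensional (free_alg X)" "fn g \<in> extensional (free_alg X)"
    using f g s by (simp_all add: Mor_iff)
  ultimately have "fn f = fn g" by (intro extensionalityI[of _ "free_alg X"])
  then show ?thesis using s t by (simp add: arrow.expand)
qed

lemma eval_cst_var: "eval cst \<sigma> (var v) = \<sigma> v"
  by (rule eval_var[OF cst_hom])

locale CA_automorphism =
  fixes X0 :: "'x set"
    and \<phi>o :: "('x, 'k::field) mpoly set \<Rightarrow> ('x, 'k) mpoly set"
    and \<phi>m :: "('x, 'k) mpoly arrow \<Rightarrow> ('x, 'k) mpoly arrow"
  assumes aut: "category_automorphism (CA X0) \<phi>o \<phi>m"
begin

lemma phi_functor: "is_functor (CA X0) (CA X0) \<phi>o \<phi>m"
  using aut by (simp add: category_automorphism_def)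

lemma phi_Ob: "A \<in> Ob (CA X0) \<Longrightarrow> \<phi>o A \<in> Ob (CA X0)"
  using phi_functor by (simp add: is_functor_def)

lemma phi_Ob_inj: "A \<in> Ob (CA X0) \<Longrightarrow> B \<in> Ob (CA X0) \<Longrightarrow> \<phi>o A = \<phi>o B \<Longrightarrow> A = B"
  using aut by (auto simp: category_automorphism_def bij_betw_def inj_on_def)

lemma phi_Mor:
  assumes "f \<in> Mor (CA X0)"
  shows "\<phi>m f \<in> Mor (CA X0)" "src (\<phi>m f) = \<phi>o (src f)" "tgt (\<phi>m f) = \<phi>o (tgt f)"
proof -
  show "\<phi>m f \<in> Mor (CA X0)" "src (\<phi>m f) = \<phi>o (src f)" "tgt (\<phi>m f) = \<phi>o (tgt f)"
    using phi_functor assms unfolding is_functor_def Dom_Cod by auto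
qed

lemma phi_Comp:
  assumes "f \<in> Mor (CA X0)" "g \<in> Mor (CA X0)" "tgt f = src g"
  shows "\<phi>m (Comp (CA X0) g f) = Comp (CA X0) (\<phi>m g) (\<phi>m f)"
proof -
  show ?thesis using phi_functor assms unfolding is_functor_def Dom_Cod by auto
qed

lemma phi_inj: "f \<in> Mor (CA X0) \<Longrightarrow> g \<in> Mor (CA X0) \<Longrightarrow> \<phi>m f = \<phi>m g \<Longrightarrow> f = g"
  using aut by (auto simp: category_automorphism_def bij_betw_def inj_on_def)

lemma phi_full:
  assumes "h \<in> Mor (CA X0)" "src h = \<phi>o A" "tgt h = \<phi>o B" "A \<in> Ob (CA X0)" "B \<in> Ob (CA X0)"
  obtains f where "f \<in> Mor (CA X0)" "src f = A" "tgt f = B" "\<phi>m f = h"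
proof -
  obtain f where f: "f \<in> Mor (CA X0)" "\<phi>m f = h"
    using aut assms(1) unfolding category_automorphism_def bij_betw_def by (metis imageE)
  moreover have "src f = A" "tgt f = B"
    using f assms phi_Mor[OF f(1)] phi_Ob_inj by (auto simp: Mor_iff)
  ultimately show ?thesis using that by blast
qed

lemma K_Ob: "free_alg {} \<in> Ob (CA X0)"
  by (auto simp: Ob_iff)

text \<open>An object with a variable \<open>y\<close> has two distinct endomorphisms, the identity and the one sending
  all variables to \<open>0\<close>, whereas \<open>K\<close> has only one.\<close>

lemma phi_K: "\<phi>o (free_alg {}) = free_alg {}"
proof -
  obtain Y where Y: "\<phi>o (free_alg {}) = free_alg Y" "finite Y" "Y \<subseteq> X0"
    using phi_Ob[OF K_Ob] by (auto simp: Ob_iff)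
  have O: "free_alg Y \<in> Ob (CA X0)" using Y by (auto simp: Ob_iff)
  have "y \<notin> Y" for y
  proof
    assume y: "y \<in> Y"
    let ?e = "\<lambda>\<sigma>. smor (free_alg Y :: ('x, 'k) mpoly set) (free_alg Y) \<sigma>"
    have M: "?e var \<in> Mor (CA X0)" "?e (\<lambda>_. 0) \<in> Mor (CA X0)"
      using Y O by (auto intro!: smor_Mor simp: var_in zero_in)
    obtain f where f: "f \<in> Mor (CA X0)" "src f = free_alg {}" "tgt f = free_alg {}" "\<phi>m f = ?e var"
      by (rule phi_full[OF M(1) _ _ K_Ob K_Ob]) (auto simp: Y)
    obtain g where g: "g \<in> Mor (CA X0)" "src g = free_alg {}" "tgt g = free_alg {}" "\<phi>m g = ?e (\<lambda>_. 0)"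
      by (rule phi_full[OF M(2) _ _ K_Ob K_Ob]) (auto simp: Y)
    have "f = g" by (rule Mor_eqI[OF f(1) g(1), of "{}"]) (auto simp: f g)
    then have "fn (?e var) (var y) = fn (?e (\<lambda>_. 0)) (var y)" using f(4) g(4) by metis
    then have "var y = (0 :: ('x, 'k) mpoly)" using y by (simp add: var_in eval_cst_var)
    then show False by (simp add: var_neq_zero)
  qed
  then have "Y = {}" by blast
  then show ?thesis using Y by simp
qed

text \<open>That every idempotent endomorphism is the identity or factors through \<open>K\<close> is preserved by \<open>\<phi>\<close>,
  and \<open>K[Z]\<close> lacks this property as soon as \<open>Z\<close> has two elements.\<close>

lemma phi_rank_one:
  assumes x: "x \<in> X0" and y: "y \<noteq> x"
  obtains z where "z \<in> X0" "\<phi>o (free_alg {x}) = free_alg {z}"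
proof -
  let ?A = "free_alg {x} :: ('x, 'k) mpoly set" and ?K = "free_alg {} :: ('x, 'k) mpoly set"
  have A: "?A \<in> Ob (CA X0)" using x by (auto simp: Ob_iff)
  obtain Z where Z: "\<phi>o ?A = free_alg Z" "finite Z" "Z \<subseteq> X0"
    using phi_Ob[OF A] by (auto simp: Ob_iff)
  have O: "free_alg Z \<in> Ob (CA X0)" using Z by (auto simp: Ob_iff)
  have "Z \<noteq> {}"
  proof
    assume "Z = {}"
    then have "\<phi>o ?A = \<phi>o ?K" using Z phi_K by simp
    then have "?A = ?K" using phi_Ob_inj A K_Ob by blast
    moreover have "var x \<in> ?A" "var x \<notin> ?K" by (simp_all add: var_in)
    ultimately show False by blast
  qed
  then obtain z where z: "z \<in> Z" by blast
  have "w = z" if w: "w \<in> Z" for w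
  proof (rule ccontr)
    assume wz: "w \<noteq> z"
    \<comment> \<open>The idempotent that kills \<open>w\<close> and keeps \<open>z\<close> comes from an idempotent \<open>g\<close> of \<open>K[x]\<close>.\<close>
    let ?\<sigma> = "\<lambda>v. if v = w then 0 else var v :: ('x, 'k) mpoly"
    let ?e = "smor (free_alg Z) (free_alg Z) ?\<sigma>"
    have e: "?e \<in> Mor (CA X0)" using Z O by (auto intro!: smor_Mor simp: var_in zero_in)
    have e_var: "fn ?e (var v) = ?\<sigma> v" if "v \<in> Z" for v using that by (simp add: var_in eval_cst_var)
    have ee: "Comp (CA X0) ?e ?e = ?e"
      by (rule Mor_eqI[OF Comp_Mor[OF e e] e, of Z])
         (auto simp: var_in eval_cst_var zero_in Mor_ops[OF e])
    obtain g where g: "g \<in> Mor (CA X0)" "src g = ?A" "tgt g = ?A" "\<phi>m g = ?e"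
      by (rule phi_full[OF e _ _ A A]) (auto simp: Z)
    have gg: "Comp (CA X0) g g = g"
      by (rule phi_inj[OF Comp_Mor[OF g(1) g(1)] g(1)]) (simp_all add: phi_Comp g ee)
    define p where "p = fn g (var x)"
    have p: "p \<in> ?A" using Mor_in[OF g(1), of "var x"] g by (simp add: p_def var_in)
    have g_eq: "g = smor ?A ?A (\<lambda>i. if i = x then p else var y)"
      by (rule Mor_eqI[OF g(1) smor_Mor, of "{x}"])
         (use p x A in \<open>auto simp: g var_in eval_cst_var p_def\<close>)
    have "fn g (fn g (var x)) = fn g (var x)"
      using gg Comp_simps(3)[of "var x" g X0 g] g by (simp add: var_in)
    then have "sub2 x p (var y) p = p"
      using p by (subst (asm) (1) g_eq) (simp add: sub2_def flip: p_def)
    from idempotent_substitution[OF y[symmetric] p this] show False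
    proof
      assume px: "p = var x"
      \<comment> \<open>Here \<open>g\<close> is the identity of \<open>K[x]\<close>, so its image is neutral under composition with every
        morphism out of \<open>K[Z]\<close>, in particular with the identity; but it kills \<open>w\<close>.\<close>
      have i: "smor (free_alg Z) (free_alg Z) var \<in> Mor (CA X0)"
        using Z O by (auto intro!: smor_Mor simp: var_in)
      obtain h where h: "h \<in> Mor (CA X0)" "src h = ?A" "tgt h = ?A" "\<phi>m h = smor (free_alg Z) (free_alg Z) var"
        by (rule phi_full[OF i _ _ A A]) (auto simp: Z)
      have hg: "Comp (CA X0) h g = h"
        by (rule Mor_eqI[OF Comp_Mor[OF g(1) h(1)] h(1), of "{x}"]) (auto simp: g h var_in px simp flip: p_def)
      then have "Comp (CA X0) (\<phi>m h) (\<phi>m g) = \<phi>m h"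
        using phi_Comp[OF g(1) h(1)] g h by simp
      then have "fn (Comp (CA X0) (smor (free_alg Z) (free_alg Z) var) ?e) (var w) = fn (smor (free_alg Z) (free_alg Z) var) (var w)"
        using g h by simp
      then have "var w = (0 :: ('x, 'k) mpoly)"
        using w Mor_ops(2)[OF i] by (simp add: var_in eval_cst_var zero_in)
      then show False by (simp add: var_neq_zero)
    next
      assume pc: "p \<in> ?K"
      \<comment> \<open>Here \<open>g\<close> factors through \<open>K\<close>, hence so does its image, which then sends the variable \<open>z\<close>
        to a constant instead of fixing it.\<close>
      let ?a = "smor ?A ?K (\<lambda>_. p)" and ?b = "smor ?K ?A var"
      have a: "?a \<in> Mor (CA X0)" using pc x K_Ob by (auto intro!: smor_Mor)
      have b: "?b \<in> Mor (CA X0)" using x A by (auto intro!: smor_Mor)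
      obtain c where c: "p = cst c" using pc by (auto simp: free_alg_empty)
      have "Comp (CA X0) ?b ?a = g"
        by (rule Mor_eqI[OF Comp_Mor[OF a b] g(1), of "{x}"])
           (use Mor_ops(1)[OF b, of c] cst_in[of c "{}"] in \<open>auto simp: g var_in eval_cst_var c simp flip: p_def\<close>)
      then have eq: "?e = Comp (CA X0) (\<phi>m ?b) (\<phi>m ?a)"
        using phi_Comp[OF a b] g by simp
      have "fn (\<phi>m ?a) (var z) \<in> ?K"
        using Mor_in[OF phi_Mor(1)[OF a]] phi_Mor[OF a] Z z phi_K by (simp add: var_in)
      then obtain d where "fn (\<phi>m ?a) (var z) = cst d" by (auto simp: free_alg_empty)
      then have "fn ?e (var z) = cst d"
        unfolding eq using Mor_ops(1)[OF phi_Mor(1)[OF b]] phi_Mor[OF a] Z z by (simp add: var_in)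
      then have "var z = (cst d :: ('x, 'k) mpoly)" using e_var[OF z] wz by simp
      then show False by (simp add: var_neq_cst)
    qed
  qed
  then have "Z = {z}" using z by blast
  then show ?thesis using that Z by auto
qed

text \<open>An element \<open>u\<close> of \<open>A\<close> is the value at \<open>x\<close> of a unique morphism \<open>K[x] \<rightarrow> A\<close>, and the image of
  this morphism under \<open>\<phi>\<close> is determined by its value at the generator \<open>z\<close> of \<open>\<phi>(K[x])\<close>.
  This gives bijections \<open>r\<close>, to be corrected by an affine map.\<close>

lemma natural_bijection_exists:
  assumes x: "x \<in> X0" and y: "y \<noteq> x"
  obtains s where
    "\<And>A. A \<in> Ob (CA X0) \<Longrightarrow> bij_betw (s A) A (\<phi>o A)"
    "\<And>\<nu> u. \<nu> \<in> Mor (CA X0) \<Longrightarrow> u \<in> src \<nu> \<Longrightarrow> fn (\<phi>m \<nu>) (s (src \<nu>) u) = s (tgt \<nu>) (fn \<nu> u)"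
    "\<And>A. A \<in> Ob (CA X0) \<Longrightarrow> s A 0 = 0" "\<And>A. A \<in> Ob (CA X0) \<Longrightarrow> s A 1 = 1"
proof -
  let ?F = "free_alg {x} :: ('x, 'k) mpoly set" and ?K = "free_alg {} :: ('x, 'k) mpoly set"
  have F: "?F \<in> Ob (CA X0)" using x by (auto simp: Ob_iff)
  obtain z where z: "z \<in> X0" "\<phi>o ?F = free_alg {z}" by (rule phi_rank_one[OF x y])
  define pt where "pt A u = smor ?F A (\<lambda>_. u)" for A and u :: "('x, 'k) mpoly"
  have pt: "pt A u \<in> Mor (CA X0)" "src (pt A u) = ?F" "tgt (pt A u) = A" "fn (pt A u) (var x) = u"
    if "A \<in> Ob (CA X0)" "u \<in> A" for A u
    using that x unfolding pt_def by (auto intro!: smor_Mor simp: var_in eval_cst_var)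
  have pt_eq: "\<nu> = pt (tgt \<nu>) (fn \<nu> (var x))" if "\<nu> \<in> Mor (CA X0)" "src \<nu> = ?F" for \<nu>
  proof -
    have "fn \<nu> (var x) \<in> tgt \<nu>" "tgt \<nu> \<in> Ob (CA X0)"
      using that Mor_in[OF that(1), of "var x"] by (auto simp: var_in Mor_iff)
    note P = pt[OF this(2) this(1)]
    show ?thesis by (rule Mor_eqI[OF that(1) P(1), of "{x}"]) (use that P in auto)
  qed
  define r where "r A u = fn (\<phi>m (pt A u)) (var z)" for A u
  have r_bij: "bij_betw (r A) A (\<phi>o A)" if A: "A \<in> Ob (CA X0)" for A
  proof (intro bij_betwI')
    fix u v assume uv: "u \<in> A" "v \<in> A"
    note U = pt[OF A uv(1)] and V = pt[OF A uv(2)]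
    show "r A u = r A v \<longleftrightarrow> u = v"
    proof
      assume "r A u = r A v"
      then have "\<phi>m (pt A u) = \<phi>m (pt A v)"
        by (intro Mor_eqI[OF phi_Mor(1)[OF U(1)] phi_Mor(1)[OF V(1)], of "{z}"])
           (auto simp: r_def phi_Mor[OF U(1)] phi_Mor[OF V(1)] U V z)
      then have "pt A u = pt A v" using phi_inj U V by blast
      then show "u = v" using U V by metis
    qed simp
  next
    fix u assume u: "u \<in> A"
    note U = pt[OF A u]
    show "r A u \<in> \<phi>o A"
      using Mor_in[OF phi_Mor(1)[OF U(1)], of "var z"] by (simp add: r_def phi_Mor[OF U(1)] U z var_in)
  next
    fix w assume w: "w \<in> \<phi>o A"
    let ?h = "smor (free_alg {z}) (\<phi>o A) (\<lambda>_. w)"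
    have h: "?h \<in> Mor (CA X0)" using w z phi_Ob[OF A] by (auto intro!: smor_Mor)
    obtain f where f: "f \<in> Mor (CA X0)" "src f = ?F" "tgt f = A" "\<phi>m f = ?h"
      by (rule phi_full[OF h _ _ F A]) (auto simp: z)
    have "fn f (var x) \<in> A" using Mor_in[OF f(1), of "var x"] f by (simp add: var_in)
    moreover have "r A (fn f (var x)) = w"
      using pt_eq[OF f(1,2)] f by (simp add: r_def var_in eval_cst_var)
    ultimately show "\<exists>u\<in>A. w = r A u" by blast
  qed
  have r_nat: "fn (\<phi>m \<nu>) (r (src \<nu>) u) = r (tgt \<nu>) (fn \<nu> u)" if \<nu>: "\<nu> \<in> Mor (CA X0)" and u: "u \<in> src \<nu>" for \<nu> u
  proof -
    have S: "src \<nu> \<in> Ob (CA X0)" using \<nu> by (simp add: Mor_iff)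
    note U = pt[OF S u]
    have "Comp (CA X0) \<nu> (pt (src \<nu>) u) = pt (tgt \<nu>) (fn \<nu> u)"
      using pt_eq[OF Comp_Mor[OF U(1) \<nu>]] U by (simp add: var_in)
    then have "Comp (CA X0) (\<phi>m \<nu>) (\<phi>m (pt (src \<nu>) u)) = \<phi>m (pt (tgt \<nu>) (fn \<nu> u))"
      using phi_Comp[OF U(1) \<nu>] U by simp
    then show ?thesis
      using Comp_simps(3)[of "var z" "\<phi>m (pt (src \<nu>) u)" X0 "\<phi>m \<nu>"] phi_Mor[OF U(1)] U z
      by (simp add: r_def var_in)
  qed
  have rK: "\<exists>c. r ?K u = cst c" if "u \<in> ?K" for u
    using bij_betwE[OF r_bij[OF K_Ob]] that phi_K by (auto simp: free_alg_empty)
  obtain b where b: "r ?K 0 = cst b" using rK zero_in by blast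
  obtain b1 where b1: "r ?K 1 = cst b1" using rK free_alg_one by blast
  have "r ?K 0 \<noteq> r ?K 1"
    using r_bij[OF K_Ob] zero_in[of "{}"] free_alg_one[of "{}"]
    by (metis bij_betw_imp_inj_on inj_on_eq_iff zero_neq_one)
  then have bb: "b1 - b \<noteq> 0" using b b1 by auto
  \<comment> \<open>The affine map taking \<open>b\<close> to \<open>0\<close> and \<open>b1\<close> to \<open>1\<close>; it has constant coefficients, so it commutes
    with all morphisms and preserves naturality.\<close>
  define a where "a = inverse (b1 - b)"
  define s where "s A u = cst a * (r A u - cst b)" for A u
  have aa: "cst a * (cst (b1 - b) * u) = u" "cst (b1 - b) * (cst a * u) = u" for u :: "('x, 'k) mpoly"
    using bb by (simp_all add: a_def flip: mult.assoc cst_simps(5)) (simp_all add: cst_simps)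
  have s_nat: "fn (\<phi>m \<nu>) (s (src \<nu>) u) = s (tgt \<nu>) (fn \<nu> u)" if \<nu>: "\<nu> \<in> Mor (CA X0)" and u: "u \<in> src \<nu>" for \<nu> u
  proof -
    have S: "src \<nu> \<in> Ob (CA X0)" using \<nu> by (simp add: Mor_iff)
    have "r (src \<nu>) u \<in> src (\<phi>m \<nu>)" using r_bij[OF S] u phi_Mor[OF \<nu>] by (auto simp: bij_betw_def)
    moreover have "src (\<phi>m \<nu>) \<in> Ob (CA X0)" using phi_Mor[OF \<nu>] phi_Ob[OF S] by simp
    ultimately show ?thesis
      by (simp add: s_def Mor_ops[OF phi_Mor(1)[OF \<nu>]] Ob_closed r_nat[OF \<nu> u])
  qed
  \<comment> \<open>Naturality along \<open>K \<rightarrow> A\<close> carries the normalization from \<open>K\<close> to every \<open>A\<close>.\<close>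
  have s01: "s A 0 = 0" "s A 1 = 1" if A: "A \<in> Ob (CA X0)" for A
  proof -
    let ?i = "smor ?K A var"
    have i: "?i \<in> Mor (CA X0)" using A by (auto intro!: smor_Mor)
    have K01: "s ?K 0 = 0" "s ?K 1 = 1"
      using bb by (simp_all add: s_def b b1 a_def flip: cst_simps(4,5)) (simp add: cst_simps)
    show "s A 0 = 0"
      using s_nat[OF i, of 0] Mor_ops[OF i] Mor_ops[OF phi_Mor(1)[OF i]] K01 by (simp add: zero_in del: smor_simps(3))
    show "s A 1 = 1"
      using s_nat[OF i, of 1] Mor_ops[OF i] Mor_ops[OF phi_Mor(1)[OF i]] K01 by (simp add: free_alg_one del: smor_simps(3))
  qed
  have s_bij: "bij_betw (s A) A (\<phi>o A)" if A: "A \<in> Ob (CA X0)" for A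
  proof -
    note cl = Ob_closed[OF phi_Ob[OF A]]
    have "bij_betw (\<lambda>u. cst a * (u - cst b)) (\<phi>o A) (\<phi>o A)"
      by (rule bij_betwI[where g = "\<lambda>u. cst (b1 - b) * u + cst b"]) (auto simp: cl aa)
    from bij_betw_trans[OF r_bij[OF A] this] show ?thesis
      by (simp add: s_def[abs_def] o_def)
  qed
  show ?thesis using that s_bij s_nat s01 by blast
qed

end

section \<open>Transport of the ring structure\<close>

locale normalized_automorphism = CA_automorphism X0 \<phi>o \<phi>m
  for X0 :: "'x set"
    and \<phi>o :: "('x, 'k::field) mpoly set \<Rightarrow> ('x, 'k) mpoly set"
    and \<phi>m :: "('x, 'k) mpoly arrow \<Rightarrow> ('x, 'k) mpoly arrow" +
  fixes s and x y
  assumes bij: "A \<in> Ob (CA X0) \<Longrightarrow> bij_betw (s A) A (\<phi>o A)"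
    and natural: "\<nu> \<in> Mor (CA X0) \<Longrightarrow> u \<in> src \<nu> \<Longrightarrow> fn (\<phi>m \<nu>) (s (src \<nu>) u) = s (tgt \<nu>) (fn \<nu> u)"
    and s0: "A \<in> Ob (CA X0) \<Longrightarrow> s A 0 = 0" and s1: "A \<in> Ob (CA X0) \<Longrightarrow> s A 1 = 1"
    and xy: "x \<in> X0" "y \<in> X0" "x \<noteq> y"
begin

abbreviation "F2 \<equiv> free_alg {x, y} :: ('x, 'k) mpoly set"

lemma F2: "F2 \<in> Ob (CA X0)"
  using xy by (auto simp: Ob_iff)

lemma s_in: "A \<in> Ob (CA X0) \<Longrightarrow> u \<in> A \<Longrightarrow> s A u \<in> \<phi>o A"
  using bij by (auto simp: bij_betw_def)

lemma s_inj: "A \<in> Ob (CA X0) \<Longrightarrow> u \<in> A \<Longrightarrow> v \<in> A \<Longrightarrow> s A u = s A v \<Longrightarrow> u = v"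
  using bij by (auto simp: bij_betw_def inj_on_def)

text \<open>A binary operation commuting with all morphisms, transported along \<open>s\<close>, is again such an
  operation; by freeness of \<open>K[x, y]\<close> it is the polynomial operation given by its value at
  \<open>(x, y)\<close>.\<close>

lemma term_operation:
  assumes cl: "\<And>B a b. B \<in> Ob (CA X0) \<Longrightarrow> a \<in> B \<Longrightarrow> b \<in> B \<Longrightarrow> op a b \<in> B"
    and hom: "\<And>\<nu> a b. \<nu> \<in> Mor (CA X0) \<Longrightarrow> a \<in> src \<nu> \<Longrightarrow> b \<in> src \<nu> \<Longrightarrow> fn \<nu> (op a b) = op (fn \<nu> a) (fn \<nu> b)"
  shows "\<exists>P\<in>F2. \<forall>B\<in>Ob (CA X0). \<forall>u\<in>B. \<forall>v\<in>B. s B (sub2 x u v P) = op (s B u) (s B v)"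
proof -
  have vs: "var x \<in> F2" "var y \<in> F2" by (simp_all add: var_in)
  have "op (s F2 (var x)) (s F2 (var y)) \<in> \<phi>o F2"
    by (intro cl phi_Ob F2 s_in vs)
  then have "op (s F2 (var x)) (s F2 (var y)) \<in> s F2 ` F2"
    using bij_betw_imp_surj_on[OF bij[OF F2]] by simp
  then obtain P where P: "op (s F2 (var x)) (s F2 (var y)) = s F2 P" "P \<in> F2"
    by (rule imageE)
  have "s B (sub2 x u v P) = op (s B u) (s B v)" if B: "B \<in> Ob (CA X0)" and uv: "u \<in> B" "v \<in> B" for B u v
  proof -
    let ?\<nu> = "smor F2 B (\<lambda>i. if i = x then u else v)"
    have \<nu>: "?\<nu> \<in> Mor (CA X0)" using B uv xy by (auto intro!: smor_Mor)
    have n: "fn (\<phi>m ?\<nu>) (s F2 q) = s B (sub2 x u v q)" if "q \<in> F2" for q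
      using natural[OF \<nu>, of q] that by (simp add: sub2_def)
    have "s B (sub2 x u v P) = fn (\<phi>m ?\<nu>) (op (s F2 (var x)) (s F2 (var y)))"
      using n[OF P(2)] P(1) by simp
    also have "\<dots> = op (fn (\<phi>m ?\<nu>) (s F2 (var x))) (fn (\<phi>m ?\<nu>) (s F2 (var y)))"
      by (rule hom[OF phi_Mor(1)[OF \<nu>]]) (simp_all add: phi_Mor[OF \<nu>] s_in F2 vs)
    also have "\<dots> = op (s B u) (s B v)"
      using n vs xy by (simp add: sub2_var)
    finally show ?thesis .
  qed
  then show ?thesis by (intro bexI[of _ P] ballI P(2))
qed

lemma F2_in: "var x \<in> F2" "var y \<in> F2" "0 \<in> F2" "1 \<in> F2"
  by (simp_all add: var_in zero_in free_alg_one)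

text \<open>The addition, the subtraction and the multiplication of the algebras \<open>\<phi>(B)\<close> become polynomials
  \<open>P\<close>, \<open>M\<close> and \<open>Q\<close>. Injectivity of \<open>s\<close> on \<open>K[x, y]\<close> turns the laws of the ring \<open>\<phi>(K[x, y])\<close> into the
  polynomial identities that characterize \<open>x + y\<close> and \<open>x y\<close>.\<close>

lemma s_add:
  assumes "A \<in> Ob (CA X0)" "u \<in> A" "v \<in> A"
  shows "s A (u + v) = s A u + s A v"
proof -
  have "\<exists>P\<in>F2. \<forall>B\<in>Ob (CA X0). \<forall>u\<in>B. \<forall>v\<in>B. s B (sub2 x u v P) = s B u + s B v"
    by (rule term_operation[of "(+)"]) (simp_all add: Ob_closed Mor_ops)
  then obtain P where P: "P \<in> F2"
    and sP: "\<And>B u v. B \<in> Ob (CA X0) \<Longrightarrow> u \<in> B \<Longrightarrow> v \<in> B \<Longrightarrow> s B (sub2 x u v P) = s B u + s B v"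
    by blast
  have "\<exists>M\<in>F2. \<forall>B\<in>Ob (CA X0). \<forall>u\<in>B. \<forall>v\<in>B. s B (sub2 x u v M) = s B u - s B v"
    by (rule term_operation[of "(-)"]) (simp_all add: Ob_closed Mor_ops)
  then obtain M where M: "M \<in> F2"
    and sM: "\<And>B u v. B \<in> Ob (CA X0) \<Longrightarrow> u \<in> B \<Longrightarrow> v \<in> B \<Longrightarrow> s B (sub2 x u v M) = s B u - s B v"
    by blast
  have id: "sub2 x (var x) (var y) q = q" if "q \<in> F2" for q
    by (rule ring_hom_on_eqI[OF sub2_hom[of "{x,y}" x "var x" "var y"], of "\<lambda>q. q"])
       (use that in \<open>auto simp: ring_hom_on_def sub2_cst sub2_var\<close>)
  have sM': "s F2 M = s F2 (var x) - s F2 (var y)"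
    using sM[OF F2, of "var x" "var y"] by (simp add: F2_in id M)
  have "sub2 x M (var y) P = var x"
    by (rule s_inj[OF F2]) (simp_all add: sM' sP F2 F2_in M P sub2_in[OF P])
  moreover have "sub2 x 0 (var y) P = var y"
    by (rule s_inj[OF F2]) (simp_all add: sP F2 F2_in P sub2_in[OF P] s0)
  moreover have "sub2 x 1 0 P = 1"
    by (rule s_inj[OF F2]) (simp_all add: sP F2 F2_in P sub2_in[OF P] s0)
  ultimately have "P = var x + var y"
    by (rule unital_invertible_operation_is_addition[OF xy(3) P M])
  then have "sub2 x u v P = u + v"
    using xy by (simp add: sub2_simps sub2_var)
  then show ?thesis using sP[OF assms] by simp
qed

lemma s_mult:
  assumes "A \<in> Ob (CA X0)" "u \<in> A" "v \<in> A"
  shows "s A (u * v) = s A u * s A v"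
proof -
  have "\<exists>Q\<in>F2. \<forall>B\<in>Ob (CA X0). \<forall>u\<in>B. \<forall>v\<in>B. s B (sub2 x u v Q) = s B u * s B v"
    by (rule term_operation[of "(*)"]) (simp_all add: Ob_closed Mor_ops)
  then obtain Q where Q: "Q \<in> F2"
    and sQ: "\<And>B u v. B \<in> Ob (CA X0) \<Longrightarrow> u \<in> B \<Longrightarrow> v \<in> B \<Longrightarrow> s B (sub2 x u v Q) = s B u * s B v"
    by blast
  have id: "sub2 x (var x) (var y) Q = Q"
    by (rule ring_hom_on_eqI[OF sub2_hom[of "{x,y}" x "var x" "var y"], of "\<lambda>q. q"])
       (use Q in \<open>auto simp: ring_hom_on_def sub2_cst sub2_var\<close>)
  have sQ': "s F2 Q = s F2 (var x) * s F2 (var y)"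
    using sQ[OF F2, of "var x" "var y"] by (simp add: F2_in id)
  have "sub2 x Q (var y) Q = sub2 x (var x) (sub2 x (var y) (var y) Q) Q"
    by (rule s_inj[OF F2]) (simp_all add: sQ F2 F2_in Q sub2_in[OF Q] sQ' mult.assoc)
  moreover have "sub2 x 0 (var y) Q = 0"
    by (rule s_inj[OF F2]) (simp_all add: sQ F2 F2_in Q sub2_in[OF Q] s0)
  moreover have "sub2 x 1 (var y) Q = var y"
    by (rule s_inj[OF F2]) (simp_all add: sQ F2 F2_in Q sub2_in[OF Q] s1)
  ultimately have "Q = var x * var y"
    by (rule unital_associative_operation_is_multiplication[OF xy(3) Q])
  then have "sub2 x u v Q = u * v"
    using xy by (simp add: sub2_simps sub2_var)
  then show ?thesis using sQ[OF assms] by simp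
qed

text \<open>The field automorphism is the restriction of \<open>s\<close> to \<open>K\<close>, read off as a constant coefficient.\<close>

lemma phi_semi_inner: "semi_inner X0 \<phi>o \<phi>m"
proof -
  let ?K = "free_alg {} :: ('x, 'k) mpoly set"
  define \<delta> where "\<delta> c = Poly_Mapping.lookup (s ?K (cst c)) 0" for c
  have lk: "Poly_Mapping.lookup (cst c :: ('x, 'k) mpoly) 0 = c" for c by (simp add: cst_def)
  have \<delta>: "s ?K (cst c) = cst (\<delta> c)" for c
    using s_in[OF K_Ob cst_in[of c]] phi_K lk unfolding \<delta>_def by (auto simp: free_alg_empty)
  have cinj: "c = d" if "cst c = (cst d :: ('x, 'k) mpoly)" for c d using that by (simp add: cst_inject)
  have "\<delta> 1 = 1" by (rule cinj) (simp add: cst_simps s1[OF K_Ob] flip: \<delta>)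
  moreover have "\<delta> (c + d) = \<delta> c + \<delta> d" for c d
    by (rule cinj) (simp add: cst_simps s_add[OF K_Ob] cst_in flip: \<delta>)
  moreover have "\<delta> (c * d) = \<delta> c * \<delta> d" for c d
    by (rule cinj) (simp add: cst_simps s_mult[OF K_Ob] cst_in flip: \<delta>)
  moreover have "bij \<delta>"
  proof (rule bijI)
    show "inj \<delta>"
      by (rule injI) (metis \<delta> cinj s_inj[OF K_Ob] cst_in)
    have "\<exists>c. d = \<delta> c" for d
    proof -
      have "cst d \<in> s ?K ` ?K" using bij[OF K_Ob] phi_K cst_in[of d "{}"] by (simp add: bij_betw_def)
      then obtain c where "cst d = s ?K (cst c)" by (auto simp: free_alg_empty)
      then show ?thesis using \<delta> cinj by metis
    qed
    then show "surj \<delta>" by (auto simp: surj_def)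
  qed
  ultimately have fa: "field_automorphism \<delta>"
    by (simp add: field_automorphism_def ring_hom_on_def)
  have s_cst: "s A (cst c) = cst (\<delta> c)" if A: "A \<in> Ob (CA X0)" for A c
  proof -
    let ?i = "smor ?K A var"
    have i: "?i \<in> Mor (CA X0)" using A by (auto intro!: smor_Mor)
    show ?thesis
      using natural[OF i, of "cst c"] Mor_ops(1)[OF i] Mor_ops(1)[OF phi_Mor(1)[OF i]]
      by (simp add: cst_in \<delta> del: smor_simps(3))
  qed
  have "semi_iso A (\<phi>o A) \<delta> (s A)" if A: "A \<in> Ob (CA X0)" for A
    using fa bij[OF A] s_in[OF A]
    by (auto simp: semi_iso_def semi_hom_def ring_hom_on_def s1 s_add s_mult A scale_cst s_cst Ob_closed(1)[OF A])
  then show ?thesis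
    unfolding semi_inner_def using fa natural by blast
qed

end

section \<open>Automorphisms of the category are semi-inner\<close>

theorem theorem4p5:
  fixes X0 :: "'x set"
    and \<phi>o :: "('x, 'k::field) mpoly set \<Rightarrow> ('x, 'k) mpoly set"
    and \<phi>m :: "('x, 'k) mpoly arrow \<Rightarrow> ('x, 'k) mpoly arrow"
  assumes "infinite X0"
    and "category_automorphism (CA X0) \<phi>o \<phi>m"
  shows "semi_inner X0 \<phi>o \<phi>m"
proof -
  obtain x y where xy: "x \<in> X0" "y \<in> X0" "x \<noteq> y"
    using infinite_arbitrarily_large[OF assms(1), of 2] by (auto simp: card_2_iff)
  interpret CA_automorphism X0 \<phi>o \<phi>m by unfold_locales (rule assms(2))
  obtain s where s: "\<And>A. A \<in> Ob (CA X0) \<Longrightarrow> bij_betw (s A) A (\<phi>o A)"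
    "\<And>\<nu> u. \<nu> \<in> Mor (CA X0) \<Longrightarrow> u \<in> src \<nu> \<Longrightarrow> fn (\<phi>m \<nu>) (s (src \<nu>) u) = s (tgt \<nu>) (fn \<nu> u)"
    "\<And>A. A \<in> Ob (CA X0) \<Longrightarrow> s A 0 = 0" "\<And>A. A \<in> Ob (CA X0) \<Longrightarrow> s A 1 = 1"
    using natural_bijection_exists[OF xy(1) xy(3)[symmetric]] by blast
  interpret normalized_automorphism X0 \<phi>o \<phi>m s x y
    by unfold_locales (fact s xy)+
  show ?thesis by (rule phi_semi_inner)
qed

end
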